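(* Let $\varphi(z)=1+B_1z+B_2z^2+B_3z^3+\cdots$ be a Ma–Minda function on $\mathbb{D}$ (so in particular $B_1>0$ and all $B_i$ are real), and let $f\in\mathcal{C}(\varphi)$ have logarithmic coefficients $\gamma_1,\gamma_2,\dots$. If $\left|B_2+\frac14B_1^2\right|\ge B_1$, then $$|\gamma_1^2-\gamma_2^2|\le \frac{B_1^2}{16}+\frac{1}{144}\left(B_2+\frac{B_1^2}{4}\right)^2.$$ The estimate is sharp: for every such $\varphi$ satisfying $\left|B_2+\frac14B_1^2\right|\ge B_1$ there is a function in $\mathcal{C}(\varphi)$ for which equality holds.
   Context: $\mathbb{D}=\{z\in\mathbb{C}:|z|<1\}$. $\mathcal{S}$ is the class of univalent analytic functions $f$ on $\mathbb{D}$ of the form $f(z)=z+\sum_{n\ge2}a_nz^n$. The logarithmic coefficients $\gamma_n=\gamma_n(f)$ of $f\in\mathcal{S}$ are defined by $\log\frac{f(z)}{z}=2\sum_{n=1}^\infty\gamma_nz^n$, $z\in\mathbb{D}$, where $\log 1=0$. A Schwarz function is an analytic $\omega:\mathbb{D}\to\mathbb{D}$ with $\omega(0)=0$. For analytic $g,h$ on $\mathbb{D}$, $g\prec h$ ($g$ is subordinate to $h$) means $g=h\circ\omega$ for some Schwarz function $\omega$. A Ma–Minda function is an analytic univalent function $\varphi$ on $\mathbb{D}$ with positive real part such that $\varphi(0)=1$, $\varphi'(0)>0$, and $\varphi(\mathbb{D})$ is symmetric with respect to the real axis and starlike with respect to $\varphi(0)=1$. Its Taylor expansion is written $\varphi(z)=1+B_1z+B_2z^2+B_3z^3+\cdots$,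 $B_1>0$. $\mathcal{C}(\varphi)=\{f\in\mathcal{S}: 1+zf''(z)/f'(z)\prec\varphi(z)\}$. *)

theory Defs
  imports "HOL-Complex_Analysis.Complex_Analysis"
begin

abbreviation unit_disc :: "complex set"
  where "unit_disc \<equiv> ball 0 1"

text \<open>
  Functions on the unit disc are total functions of type \<^typ>\<open>complex \<Rightarrow> complex\<close>;
  their values outside the disc never matter.
\<close>

definition taylor_coeff :: "(complex \<Rightarrow> complex) \<Rightarrow> nat \<Rightarrow> complex"
  where "taylor_coeff f n = (deriv ^^ n) f 0 / fact n"

definition class_S :: "(complex \<Rightarrow> complex) set"
  where "class_S = {f. f holomorphic_on unit_disc \<and> inj_on f unit_disc \<and>
                       f 0 = 0 \<and> deriv f 0 = 1}"

text \<open>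
  The analytic branch of \<open>log (f(z)/z)\<close> on the disc with \<open>log 1 = 0\<close>. The quotient has
  value \<open>1\<close> at the removable singularity \<open>0\<close>, whence \<open>L 0 = 0\<close>.
\<close>

definition is_log_branch :: "(complex \<Rightarrow> complex) \<Rightarrow> (complex \<Rightarrow> complex) \<Rightarrow> bool"
  where "is_log_branch f L \<longleftrightarrow>
           L holomorphic_on unit_disc \<and> L 0 = 0 \<and>
           (\<forall>z\<in>unit_disc - {0}. exp (L z) = f z / z)"

text \<open>
  For \<open>f\<close> in \<^const>\<open>class_S\<close> the branch exists and is unique on the disc, and the
  coefficients below satisfy the expansion of \<open>log (f(z)/z)\<close> by which they are usually
  introduced; see the lemmas at the end.
\<close>

definition log_coeff :: "(complex \<Rightarrow> complex) \<Rightarrow> nat \<Rightarrow> complex"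
  where "log_coeff f n = taylor_coeff (SOME L. is_log_branch f L) n / 2"

definition schwarz_function :: "(complex \<Rightarrow> complex) \<Rightarrow> bool"
  where "schwarz_function \<omega> \<longleftrightarrow>
           \<omega> holomorphic_on unit_disc \<and> \<omega> ` unit_disc \<subseteq> unit_disc \<and> \<omega> 0 = 0"

definition subordinate :: "(complex \<Rightarrow> complex) \<Rightarrow> (complex \<Rightarrow> complex) \<Rightarrow> bool"
  where "subordinate g h \<longleftrightarrow>
           g holomorphic_on unit_disc \<and> h holomorphic_on unit_disc \<and>
           (\<exists>\<omega>. schwarz_function \<omega> \<and> (\<forall>z\<in>unit_disc. g z = h (\<omega> z)))"

definition ma_minda :: "(complex \<Rightarrow> complex) \<Rightarrow> bool"
  where "ma_minda \<phi> \<longleftrightarrow>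
           \<phi> holomorphic_on unit_disc \<and> inj_on \<phi> unit_disc \<and>
           (\<forall>z\<in>unit_disc. 0 < Re (\<phi> z)) \<and>
           \<phi> 0 = 1 \<and> deriv \<phi> 0 \<in> \<real> \<and> 0 < Re (deriv \<phi> 0) \<and>
           cnj ` \<phi> ` unit_disc = \<phi> ` unit_disc \<and>
           (\<forall>w\<in>\<phi> ` unit_disc. closed_segment 1 w \<subseteq> \<phi> ` unit_disc)"

definition class_C :: "(complex \<Rightarrow> complex) \<Rightarrow> (complex \<Rightarrow> complex) set"
  where "class_C \<phi> = {f \<in> class_S.
           subordinate (\<lambda>z. 1 + z * deriv (deriv f) z / deriv f z) \<phi>}"

lemma is_log_branch_exists:
  assumes "f \<in> class_S"
  shows "\<exists>L. is_log_branch f L"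
proof -
  have hol: "f holomorphic_on unit_disc" and inj: "inj_on f unit_disc"
    and f0: "f 0 = 0" and f1: "deriv f 0 = 1"
    using assms by (auto simp: class_S_def)
  define q where "q = (\<lambda>z. if z = 0 then 1 else f z / z)"
  have q: "q holomorphic_on unit_disc"
    using pole_lemma_open[OF hol open_ball, of 0] f0 f1
    by (simp add: q_def if_distrib cong: if_cong)
  have nz: "q z \<noteq> 0" if "z \<in> unit_disc" for z
    using inj_onD[OF inj, of z 0] that f0 by (auto simp: q_def)
  have "simply_connected unit_disc"
    by (simp add: convex_imp_simply_connected)
  then obtain g where g: "g holomorphic_on unit_disc" "\<And>z. z \<in> unit_disc \<Longrightarrow> q z = exp (g z)"
    using simply_connected_eq_holomorphic_log[OF open_ball, of 0 1] q nz by metis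
  have "exp (g 0) = 1"
    using g(2)[of 0] by (simp add: q_def)
  moreover have "exp (g z) = f z / z" if "z \<in> unit_disc - {0}" for z
    using g(2)[of z] that by (simp add: q_def)
  ultimately have "is_log_branch f (\<lambda>z. g z - g 0)"
    unfolding is_log_branch_def using g(1)
    by (auto intro!: holomorphic_intros simp: exp_diff)
  then show ?thesis by blast
qed

lemma is_log_branch_unique:
  assumes "is_log_branch f L" "is_log_branch f M" "z \<in> unit_disc"
  shows "L z = M z"
proof -
  define h where "h = (\<lambda>z. L z - M z)"
  have hol: "h holomorphic_on unit_disc"
    using assms unfolding h_def is_log_branch_def by (auto intro!: holomorphic_intros)
  have e: "exp (h w) = 1" if "w \<in> unit_disc" for w
  proof (cases "w = 0")
    case True
    then show ?thesis using assms by (simp add: h_def is_log_branch_def)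
  next
    case False
    then have "exp (L w) = exp (M w)"
      using assms that by (simp add: is_log_branch_def)
    then show ?thesis by (simp add: h_def exp_diff)
  qed
  have "(h has_field_derivative 0) (at w)" if w: "w \<in> unit_disc" for w
  proof -
    have d: "(h has_field_derivative deriv h w) (at w)"
      using hol w holomorphic_derivI open_ball by blast
    have "((\<lambda>z. exp (h z)) has_field_derivative exp (h w) * deriv h w) (at w)"
      by (rule DERIV_fun_exp[OF d])
    moreover have "((\<lambda>z. exp (h z)) has_field_derivative 0) (at w)"
      by (rule has_field_derivative_transform_within_open[where f = "\<lambda>_. 1", OF _ open_ball w])
        (use e in auto)
    ultimately have "exp (h w) * deriv h w = 0"
      by (rule DERIV_unique)
    then show ?thesis using d by simp
  qed
  then have "\<exists>c. \<forall>w\<in>unit_disc. h w = c"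
    using has_field_derivative_zero_constant[of unit_disc h]
    by (auto intro: has_field_derivative_at_within)
  moreover have "h 0 = 0"
    using assms by (simp add: h_def is_log_branch_def)
  ultimately have "h z = 0"
    using assms(3) by force
  then show ?thesis by (simp add: h_def)
qed

lemma log_coeff_sums:
  assumes "f \<in> class_S" "is_log_branch f L" "z \<in> unit_disc"
  shows "(\<lambda>n. 2 * log_coeff f (Suc n) * z ^ Suc n) sums L z"
proof -
  define M where "M = (SOME L. is_log_branch f L)"
  have M: "is_log_branch f M"
    unfolding M_def using is_log_branch_exists[OF assms(1)] by (rule someI_ex)
  have lc: "log_coeff f n = taylor_coeff M n / 2" for n
    by (simp only: log_coeff_def M_def)
  have "(\<lambda>n. 2 * log_coeff f n * z ^ n) sums M z"
    using holomorphic_power_series[of M 0 1 z] M assms(3)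
    by (simp add: is_log_branch_def lc taylor_coeff_def)
  moreover have "log_coeff f 0 = 0"
    using M by (simp add: is_log_branch_def lc taylor_coeff_def)
  ultimately have "(\<lambda>n. 2 * log_coeff f (Suc n) * z ^ Suc n) sums M z"
    by (subst sums_Suc_iff) simp
  then show ?thesis
    using is_log_branch_unique[OF M assms(2,3)] by simp
qed

end

theory Submission
  imports Defs
begin

text \<open>
  Comparing coefficients in \<open>1 + z f''/f' = \<phi> \<circ> \<omega>\<close> with \<open>\<omega>(z) = c\<^sub>1 z + c\<^sub>2 z\<^sup>2 + \<dots>\<close> gives
  \<open>\<gamma>\<^sub>1 = B\<^sub>1 c\<^sub>1 / 4\<close> and \<open>\<gamma>\<^sub>2 = (B\<^sub>1 c\<^sub>2 + (B\<^sub>2 + B\<^sub>1\<^sup>2/4) c\<^sub>1\<^sup>2) / 12\<close>. The bound follows from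
  \<open>|c\<^sub>2| \<le> 1 - |c\<^sub>1|\<^sup>2\<close> and \<open>B\<^sub>1 \<le> |B\<^sub>2 + B\<^sub>1\<^sup>2/4|\<close>. For \<open>\<omega>(z) = \<i> z\<close> the numbers
  \<open>\<gamma>\<^sub>1\<^sup>2\<close> and \<open>\<gamma>\<^sub>2\<^sup>2\<close> have opposite signs and equality holds; the corresponding \<open>f\<close>, obtained by two
  integrations, is univalent because \<open>Re (1 + z f''/f') > 0\<close> makes the image of every circle
  \<open>|z| = r\<close> a closed curve whose tangent turns monotonically by \<open>2\<pi>\<close> in all.
\<close>

section \<open>Ma-Minda functions have real Taylor coefficients\<close>

text \<open>Conjugating the power series at the conjugate point term by term gives a second
  expansion of \<open>f\<close>; uniqueness makes each coefficient equal to its conjugate.\<close>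

lemma taylor_coeff_real_if_conj_symmetric:
  assumes hol: "f holomorphic_on unit_disc"
    and sym: "\<And>z. z \<in> unit_disc \<Longrightarrow> cnj (f (cnj z)) = f z"
  shows "taylor_coeff f n \<in> \<real>"
proof -
  define F where "F = fps_expansion f 0"
  have F: "f has_fps_expansion F"
    unfolding F_def by (rule has_fps_expansion_fps_expansion[OF open_ball _ hol]) simp
  have "f has_fps_expansion Abs_fps (\<lambda>n. cnj (fps_nth F n))"
  proof (rule has_fps_expansionI)
    have "eventually (\<lambda>z. z \<in> unit_disc) (nhds (0::complex))"
      by (rule eventually_nhds_in_open) auto
    then show "\<forall>\<^sub>F z in nhds 0. (\<lambda>n. fps_nth (Abs_fps (\<lambda>n. cnj (fps_nth F n))) n * z ^ n) sums f z"
    proof eventually_elim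
      case (elim z)
      have "(\<lambda>n. (deriv ^^ n) f 0 / fact n * cnj z ^ n) sums f (cnj z)"
        using holomorphic_power_series[OF hol, of "cnj z"] elim by simp
      then have "(\<lambda>n. cnj ((deriv ^^ n) f 0 / fact n * cnj z ^ n)) sums cnj (f (cnj z))"
        by (simp only: sums_cnj)
      then show ?case
        using sym[OF elim] by (simp add: F_def fps_expansion_def)
    qed
  qed
  from fps_expansion_unique_complex[OF F this]
  have "fps_nth F n = cnj (fps_nth F n)"
    by (metis fps_nth_Abs_fps)
  moreover have "fps_nth F n = taylor_coeff f n"
    by (simp add: F_def fps_expansion_def taylor_coeff_def)
  ultimately show ?thesis
    by (metis Reals_cnj_iff)
qed

text \<open>The reflection \<open>\<psi>\<close> of \<open>\<phi>\<close> has the same image as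
  \<open>\<phi>\<close>, so the inverse of \<open>\<phi>\<close> composed with \<open>\<psi>\<close>
  is a self-map \<open>k\<close> of the disc that fixes 0. Its derivative there is 1, and the
  equality case of the Schwarz lemma makes it the identity.\<close>

lemma ma_minda_symmetric:
  assumes "ma_minda \<phi>" "z \<in> unit_disc"
  shows "cnj (\<phi> (cnj z)) = \<phi> z"
proof -
  have hol: "\<phi> holomorphic_on unit_disc" and inj: "inj_on \<phi> unit_disc"
    and one: "\<phi> 0 = 1" and re: "deriv \<phi> 0 \<in> \<real>" and pos: "0 < Re (deriv \<phi> 0)"
    and sym: "cnj ` \<phi> ` unit_disc = \<phi> ` unit_disc"
    using assms(1) by (auto simp: ma_minda_def)
  obtain g where g: "g holomorphic_on (\<phi> ` unit_disc)"
    "\<And>z. z \<in> unit_disc \<Longrightarrow> deriv \<phi> z * deriv g (\<phi> z) = 1"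
    "\<And>z. z \<in> unit_disc \<Longrightarrow> g (\<phi> z) = z"
    using holomorphic_has_inverse[OF hol open_ball inj] by metis
  define \<psi> where "\<psi> = cnj \<circ> \<phi> \<circ> cnj"
  define k where "k = g \<circ> \<psi>"
  have cnj_disc: "cnj ` unit_disc = unit_disc"
    by (auto simp: image_iff intro!: bexI[of _ "cnj _"])
  have h\<psi>: "\<psi> holomorphic_on unit_disc"
    unfolding \<psi>_def using holomorphic_on_compose_cnj_cnj[of \<phi> unit_disc] hol cnj_disc by simp
  have im: "\<psi> ` unit_disc = \<phi> ` unit_disc"
    unfolding \<psi>_def using sym cnj_disc by (metis image_comp)
  have hk: "k holomorphic_on unit_disc"
    unfolding k_def using g(1) h\<psi> im by (intro holomorphic_on_compose) auto
  have \<phi>k: "\<phi> (k w) = \<psi> w" and kD: "k w \<in> unit_disc" if w: "w \<in> unit_disc" for w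
  proof -
    obtain v where "v \<in> unit_disc" "\<psi> w = \<phi> v" using im w by blast
    then show "\<phi> (k w) = \<psi> w" "k w \<in> unit_disc" using g(3) by (auto simp: k_def)
  qed
  have k0: "k 0 = 0" using g(3)[of 0] one by (simp add: k_def \<psi>_def)
  have d\<phi>: "(\<phi> has_field_derivative deriv \<phi> 0) (at 0)"
    using holomorphic_derivI[OF hol open_ball, of 0] by simp
  have "(\<psi> has_field_derivative cnj (deriv \<phi> 0)) (at 0)"
    using has_field_derivative_cnj_cnj[of \<phi> "deriv \<phi> 0" 0] d\<phi> by (simp add: \<psi>_def)
  \<comment> \<open>Reality of \<open>deriv \<phi> 0\<close> makes \<open>\<psi>\<close> and
    \<open>\<phi>\<close> agree to first order at 0, which forces
    \<open>deriv k 0 = 1\<close>.\<close>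
  then have "(\<psi> has_field_derivative deriv \<phi> 0) (at 0)"
    using re by (simp add: Reals_cnj_iff)
  moreover have dk: "(k has_field_derivative deriv k 0) (at 0)"
    using holomorphic_derivI[OF hk open_ball, of 0] by simp
  have "((\<lambda>w. \<phi> (k w)) has_field_derivative deriv \<phi> 0 * deriv k 0) (at 0)"
    using DERIV_chain2[of \<phi> "deriv \<phi> 0" k 0] d\<phi> dk k0 by simp
  then have "(\<psi> has_field_derivative deriv \<phi> 0 * deriv k 0) (at 0)"
    by (rule has_field_derivative_transform_within_open[OF _ open_ball[of 0 1]]) (auto simp: \<phi>k)
  ultimately have "deriv \<phi> 0 * deriv k 0 = deriv \<phi> 0"
    by (rule DERIV_unique[symmetric])
  then have k1: "deriv k 0 = 1" using pos by auto
  have nk: "norm (k z) < 1" if "norm z < 1" for z using kD[of z] that by simp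
  obtain \<alpha> where \<alpha>: "\<forall>z. norm z < 1 \<longrightarrow> k z = \<alpha> * z"
    using Schwarz_Lemma(3)[OF hk k0 nk, of 0] k1 by auto
  have "(k has_field_derivative \<alpha>) (at 0)"
    by (rule has_field_derivative_transform_within_open[of "\<lambda>z. \<alpha> * z" _ _ "unit_disc"])
      (auto intro!: derivative_eq_intros simp: \<alpha>)
  with dk k1 have "\<alpha> = 1" using DERIV_unique by metis
  with \<alpha> assms(2) have "k z = z" by simp
  with \<phi>k[OF assms(2)] show ?thesis by (simp add: \<psi>_def)
qed

section \<open>The first two coefficients of a Schwarz function\<close>

text \<open>If \<open>\<omega> z = z * g z\<close>, the two coefficients are \<open>g 0\<close> and
  \<open>deriv g 0\<close>, and the second bound is the Schwarz-Pick inequality for \<open>g\<close>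
  at 0.\<close>

lemma schwarz_function_coeffs:
  assumes "schwarz_function \<omega>"
  shows "cmod (taylor_coeff \<omega> 1) \<le> 1"
    and "cmod (taylor_coeff \<omega> 2) \<le> 1 - (cmod (taylor_coeff \<omega> 1))\<^sup>2"
proof -
  have hol: "\<omega> holomorphic_on unit_disc" and \<omega>0: "\<omega> 0 = 0"
    and n\<omega>: "\<And>z. norm z < 1 \<Longrightarrow> norm (\<omega> z) < 1"
    using assms unfolding schwarz_function_def by force+
  obtain g where hg: "g holomorphic_on unit_disc"
    and g: "\<And>z. norm z < 1 \<Longrightarrow> \<omega> z = z * g z" and d: "deriv \<omega> 0 = g 0"
    using Schwarz3[OF hol \<omega>0] by metis
  have c1: "taylor_coeff \<omega> 1 = g 0" by (simp add: taylor_coeff_def d)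
  have c2: "taylor_coeff \<omega> 2 = deriv g 0"
  proof -
    have "\<omega> has_fps_expansion fps_expansion \<omega> 0"
      by (rule has_fps_expansion_fps_expansion[OF open_ball _ hol]) simp
    moreover have "(\<lambda>z. z * g z) has_fps_expansion fps_X * fps_expansion g 0"
      by (intro fps_expansion_intros has_fps_expansion_fps_expansion[OF open_ball _ hg]) simp
    moreover have "eventually (\<lambda>z. z \<in> unit_disc) (nhds (0::complex))"
      by (rule eventually_nhds_in_open) auto
    then have "\<forall>\<^sub>F z in nhds 0. \<omega> z = z * g z"
      by eventually_elim (simp add: g)
    ultimately have "fps_expansion \<omega> 0 = fps_X * fps_expansion g 0"
      using has_fps_expansion_cong fps_expansion_unique_complex by metis
    then have "fps_nth (fps_expansion \<omega> 0) 2 = fps_nth (fps_X * fps_expansion g 0) 2" by simp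
    then show ?thesis by (simp add: fps_expansion_def taylor_coeff_def)
  qed
  show le: "cmod (taylor_coeff \<omega> 1) \<le> 1"
    using Schwarz_Lemma(2)[OF hol \<omega>0 n\<omega>, of 0] by (simp add: taylor_coeff_def)
  show "cmod (taylor_coeff \<omega> 2) \<le> 1 - (cmod (taylor_coeff \<omega> 1))\<^sup>2"
  \<comment> \<open>The equality case of the Schwarz lemma, where \<open>\<omega>\<close> is a
    rotation, is split off: there \<open>g\<close> has modulus 1, whereas the Moebius argument needs
    values of \<open>g\<close> in the open disc.\<close>
  proof (cases "(\<exists>z. norm z < 1 \<and> z \<noteq> 0 \<and> norm (\<omega> z) = norm z) \<or> norm (deriv \<omega> 0) = 1")
    case True
    then obtain \<alpha> where \<alpha>: "\<forall>z. norm z < 1 \<longrightarrow> \<omega> z = \<alpha> * z" "norm \<alpha> = 1"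
      using Schwarz_Lemma(3)[OF hol \<omega>0 n\<omega>, of 0] by auto
    have "\<forall>\<^sub>F z in nhds 0. \<omega> z = \<alpha> * z"
      using eventually_nhds_in_open[of unit_disc 0] \<alpha>(1) by (auto elim!: eventually_mono)
    then have eq: "(deriv ^^ n) \<omega> 0 = (deriv ^^ n) (\<lambda>z. \<alpha> * z) 0" for n
      by (intro higher_deriv_cong_ev) auto
    have "taylor_coeff \<omega> 1 = \<alpha>" "taylor_coeff \<omega> 2 = 0"
      using eq[of 1] eq[of 2] by (simp_all add: taylor_coeff_def numeral_2_eq_2)
    then show ?thesis using \<alpha>(2) by simp
  next
    case False
    have ng: "norm (g z) < 1" if z: "norm z < 1" for z
    proof (cases "z = 0")
      case True then show ?thesis
        using False le c1 d by (auto simp: taylor_coeff_def)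
    next
      case nz: False
      have "norm (\<omega> z) \<le> norm z" using Schwarz_Lemma(1)[OF hol \<omega>0 n\<omega>] z by auto
      moreover have "norm (\<omega> z) \<noteq> norm z" using False z nz by auto
      ultimately show ?thesis using nz g[OF z] by (simp add: norm_mult)
    qed
    define a where "a = g 0"
    have na: "norm a < 1" using ng[of 0] by (simp add: a_def)
    \<comment> \<open>The Moebius map sends \<open>a\<close> to 0, so the Schwarz lemma applies to
      \<open>h\<close>; the derivative of \<open>h\<close> at 0 is that of \<open>g\<close> divided
      by 1 - |a|^2.\<close>
    define h where "h = Moebius_function 0 a \<circ> g"
    have hh: "h holomorphic_on unit_disc"
      unfolding h_def
      by (rule holomorphic_on_compose_gen[OF hg Moebius_function_holomorphic[OF na]])
        (use ng in auto)
    have h0: "h 0 = 0" by (simp add: h_def a_def Moebius_function_eq_zero)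
    have nh: "norm (h z) < 1" if "norm z < 1" for z
      unfolding h_def using Moebius_function_norm_lt_1[OF na ng[OF that]] by simp
    have na2: "(norm a)\<^sup>2 < 1" using na by (simp add: power_less_one_iff abs_square_less_1)
    have eq: "1 - cnj a * a = of_real (1 - (norm a)\<^sup>2)"
      by (simp add: complex_norm_square mult.commute flip: of_real_power)
    have nz: "1 - cnj a * a \<noteq> 0"
      unfolding eq of_real_eq_0_iff using na2 by simp
    have dg: "(g has_field_derivative deriv g 0) (at 0)"
      using holomorphic_derivI[OF hg open_ball, of 0] by simp
    have "((\<lambda>z. (g z - a) / (1 - cnj a * g z)) has_field_derivative deriv g 0 / (1 - cnj a * a)) (at 0)"
      by (rule derivative_eq_intros dg refl | use nz in \<open>simp add: a_def[symmetric]\<close>)+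
    then have "deriv h 0 = deriv g 0 / (1 - cnj a * a)"
      by (intro DERIV_imp_deriv) (simp add: h_def o_def Moebius_function_simple[abs_def])
    moreover have "norm (deriv h 0) \<le> 1"
      by (rule Schwarz_Lemma(2)[OF hh h0 nh, of 0]) auto
    ultimately have "norm (deriv g 0) \<le> norm (1 - cnj a * a)"
      using nz by (simp add: norm_divide field_simps)
    then have "norm (deriv g 0) \<le> 1 - (norm a)\<^sup>2"
      unfolding eq norm_of_real using na2 by simp
    then show ?thesis unfolding c1 c2 a_def .
  qed
qed

section \<open>Univalence from positivity of Re (1 + z f''/f')\<close>

text \<open>
  Seen from the direction of the tangent at the first point, an arc that turns left by at
  most \<open>\<pi>\<close> never moves back to the right-hand side.
\<close>
lemma turning_arc_endpoints_distinct:
  fixes \<gamma> :: "real \<Rightarrow> complex" and \<rho> \<theta> :: "real \<Rightarrow> real"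
  assumes der: "\<And>x. (\<gamma> has_vector_derivative of_real (\<rho> x) * cis (\<theta> x)) (at x)"
    and pos: "\<And>x. 0 < \<rho> x" and mono: "strict_mono \<theta>"
    and "s < t" "\<theta> t - \<theta> s \<le> pi"
  shows "\<gamma> s \<noteq> \<gamma> t"
proof -
  define h where "h x = Im (cis (- \<theta> s) * \<gamma> x)" for x
  have dh: "(h has_real_derivative \<rho> x * sin (\<theta> x - \<theta> s)) (at x)" for x
  proof -
    have "((\<lambda>x. cis (- \<theta> s) * \<gamma> x) has_vector_derivative
        cis (- \<theta> s) * (of_real (\<rho> x) * cis (\<theta> x))) (at x)"
      by (rule has_vector_derivative_mult_right[OF der])
    also have "cis (- \<theta> s) * (of_real (\<rho> x) * cis (\<theta> x)) = of_real (\<rho> x) * cis (\<theta> x - \<theta> s)"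
      by (simp add: cis_mult mult.left_commute)
    finally show ?thesis
      unfolding h_def has_real_derivative_iff_has_vector_derivative
      using bounded_linear.has_vector_derivative[OF bounded_linear_Im] by fastforce
  qed
  \<comment> \<open>\<open>h\<close> measures the offset from the tangent line at \<open>s\<close>.
    Its derivative vanishes at \<open>s\<close>, and also at \<open>t\<close> if the turning is
    exactly \<open>pi\<close>, so positivity is available on the open interval only.\<close>
  have "h s < h t"
  proof (rule DERIV_pos_imp_increasing_open[OF \<open>s < t\<close>])
    fix x assume "s < x" "x < t"
    then have "\<theta> s < \<theta> x" "\<theta> x < \<theta> t"
      using mono by (auto simp: strict_mono_def)
    with assms(5) have "0 < \<rho> x * sin (\<theta> x - \<theta> s)"
      by (intro mult_pos_pos pos sin_gt_zero) auto
    then show "\<exists>y. DERIV h x :> y \<and> 0 < y" using dh by blast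
  next
    show "continuous_on {s..t} h"
      using dh by (meson DERIV_continuous continuous_at_imp_continuous_on)
  qed
  then show ?thesis by (auto simp: h_def)
qed

text \<open>One period turns the tangent by 2 pi in all. Of the two arcs joining the points at
  \<open>s\<close> and \<open>t\<close>, one therefore turns by at most pi, and such an arc has
  distinct endpoints.\<close>

lemma convex_closed_curve_inj_on:
  fixes \<gamma> :: "real \<Rightarrow> complex" and \<rho> \<theta> :: "real \<Rightarrow> real"
  assumes der: "\<And>x. (\<gamma> has_vector_derivative of_real (\<rho> x) * cis (\<theta> x)) (at x)"
    and pos: "\<And>x. 0 < \<rho> x" and mono: "strict_mono \<theta>"
    and per: "\<And>x. \<gamma> (x + 2 * pi) = \<gamma> x" "\<And>x. \<theta> (x + 2 * pi) = \<theta> x + 2 * pi"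
  shows "inj_on \<gamma> {0..<2 * pi}"
proof (rule linorder_inj_onI)
  fix s t :: real
  assume st: "s < t" "s \<in> {0..<2 * pi}" "t \<in> {0..<2 * pi}"
  note D = turning_arc_endpoints_distinct[OF der pos mono]
  show "\<gamma> s \<noteq> \<gamma> t"
  proof (cases "\<theta> t - \<theta> s \<le> pi")
    case True then show ?thesis using D st by blast
  next
    case False
    then have "\<theta> (s + 2 * pi) - \<theta> t \<le> pi" by (simp add: per)
    moreover have "t < s + 2 * pi" using st by simp
    ultimately have "\<gamma> t \<noteq> \<gamma> (s + 2 * pi)" using D by blast
    then show ?thesis by (simp add: per)
  qed
qed auto

text \<open>
  The number of solutions of \<open>f z = w\<close> inside a circle is the winding number about \<open>w\<close> of
  the image of the circle, a simple closed curve; hence it is at most one.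
\<close>
lemma inj_on_ball_if_inj_on_spheres:
  fixes f :: "complex \<Rightarrow> complex"
  assumes hol: "f holomorphic_on ball 0 R"
    and inj: "\<And>r. 0 < r \<Longrightarrow> r < R \<Longrightarrow> inj_on f (sphere 0 r)"
  shows "inj_on f (ball 0 R)"
proof (rule ccontr)
  assume "\<not> inj_on f (ball 0 R)"
  then obtain a b where ab: "a \<in> ball 0 R" "b \<in> ball 0 R" "a \<noteq> b" "f a = f b"
    by (auto simp: inj_on_def)
  define w where "w = f a"
  define F where "F = (\<lambda>z. f z - w)"
  define m where "m = max (norm a) (norm b)"
  have m: "m < R" "0 < m" using ab by (auto simp: m_def less_max_iff_disj)
  obtain q where q: "m < q" "q < R" using m dense by blast
  have hF: "F holomorphic_on ball 0 R"
    unfolding F_def by (intro holomorphic_intros hol)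
  \<comment> \<open>A constant \<open>F\<close> would identify the points \<open>m\<close> and
    \<open>-m\<close> of a single circle.\<close>
  have nc: "\<not> F constant_on ball 0 R"
  proof
    assume "F constant_on ball 0 R"
    then have "F (of_real m) = F (- of_real m)"
      using m by (auto simp: constant_on_def)
    then have "(of_real m :: complex) = - of_real m"
      using inj_onD[OF inj[OF m(2,1)], of "of_real m" "- of_real m"] m by (simp add: F_def)
    then have "of_real (2 * m) = (0 :: complex)" by simp
    then show False using m by (simp only: of_real_eq_0_iff)
  qed
  have fin: "finite {z \<in> cball 0 q. F z = 0}"
    by (rule holomorphic_compact_finite_zeros[OF hF open_ball connected_ball compact_cball _ nc])
      (use q in auto)
  \<comment> \<open>Finitely many zeros block only finitely many radii, so some circle encloses both
    \<open>a\<close> and \<open>b\<close> and carries no zero of \<open>F\<close>.\<close>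
  have "infinite ({m<..<q} - norm ` {z \<in> cball 0 q. F z = 0})"
    using fin q by (intro Diff_infinite_finite) auto
  then obtain r where r: "m < r" "r < q" "r \<notin> norm ` {z \<in> cball 0 q. F z = 0}"
    by (metis (no_types, lifting) DiffE finite.emptyI greaterThanLessThan_iff equals0I)
  have r0: "0 < r" "r < R" using r m q by auto
  define p where "p = circlepath 0 r"
  have imp: "path_image p = sphere 0 r" using r0 by (simp add: p_def)
  have vp: "valid_path p" and lp: "pathfinish p = pathstart p" by (simp_all add: p_def)
  \<comment> \<open>The set \<open>{}\<close> stands for the poles, in the shape that
    \<open>argument_principle\<close> expects; the weight function there is taken to be the constant
    1.\<close>
  define pz where "pz = {z \<in> ball 0 q. F z = 0 \<or> z \<in> {}}"
  have finpz: "finite pz"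
    by (rule finite_subset[OF _ fin]) (auto simp: pz_def)
  have impz: "path_image p \<subseteq> ball 0 q - pz"
    using r by (auto simp: imp pz_def)
  have AP: "contour_integral p (\<lambda>x. deriv F x * 1 / F x) =
      2 * pi * \<i> * (\<Sum>z\<in>pz. winding_number p z * 1 * zorder F z)"
    unfolding pz_def
  proof (rule argument_principle)
    show "F holomorphic_on ball 0 q - {}" using hF q by (auto intro: holomorphic_on_subset)
    show "\<forall>z. z \<notin> ball 0 q \<longrightarrow> winding_number p z = 0"
      using winding_number_zero_outside[of p "ball 0 q"] vp lp impz
      by (auto simp: valid_path_imp_path)
  qed (use vp lp impz finpz in \<open>simp_all add: pz_def\<close>)
  \<comment> \<open>\<open>pz\<close> may also contain zeros outside the circle; the circle does not
    wind around those.\<close>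
  have wn: "winding_number p z = (if norm z < r then 1 else 0)" if "z \<in> pz" for z
  proof (cases "norm z < r")
    case True then show ?thesis by (simp add: p_def winding_number_circlepath)
  next
    case False
    then have "z \<notin> cball 0 r" using that impz imp by (cases "norm z = r") auto
    then show ?thesis
      using False winding_number_zero_outside[of p "cball 0 r" z] vp lp imp
      by (auto simp: valid_path_imp_path)
  qed
  have zo: "zorder F z \<ge> 1" if "z \<in> pz" for z
  proof -
    have "\<exists>u\<in>ball 0 R. F u \<noteq> 0" using nc by (force simp: constant_on_def)
    then show ?thesis
      using zorder_exist_zero[OF hF open_ball connected_ball, of z] that q
      by (auto simp: pz_def split: if_splits)
  qed
  define N where "N = (\<Sum>z\<in>pz. (if norm z < r then 1 else 0) * zorder F z)"
  have "winding_number (f \<circ> p) w = of_int N"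
  proof -
    have ana: "F analytic_on ball 0 R" using hF by (simp add: analytic_on_open)
    have vF: "valid_path (F \<circ> p)"
      by (rule valid_path_compose_holomorphic[OF vp hF open_ball]) (use imp r0 in auto)
    have "0 \<notin> path_image (F \<circ> p)"
      using impz by (auto simp: path_image_compose pz_def)
    then have "winding_number (F \<circ> p) 0 = 1 / (2 * pi * \<i>) * contour_integral (F \<circ> p) (\<lambda>u. 1 / (u - 0))"
      by (rule winding_number_valid_path[OF vF])
    also have "contour_integral (F \<circ> p) (\<lambda>u. 1 / (u - 0)) = contour_integral p (\<lambda>x. deriv F x * 1 / F x)"
    proof -
      have "path_image p \<subseteq> ball 0 R" using imp r0 by auto
      from contour_integral_comp_analyticW[OF ana vp this, of "\<lambda>u. 1 / (u - 0)"]
      show ?thesis by simp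
    qed
    also have "1 / (2 * pi * \<i>) * \<dots> = of_int N"
      unfolding AP N_def by (simp add: wn, intro sum.cong) auto
    also have "winding_number (F \<circ> p) 0 = winding_number (f \<circ> p) w"
      using winding_number_offset[of "f \<circ> p" w] by (simp add: F_def o_def)
    finally show ?thesis .
  qed
  \<comment> \<open>Injectivity on the sphere makes the image of the circle a simple closed path,
    which winds at most once.\<close>
  moreover have "winding_number (f \<circ> p) w \<in> {-1, 0, 1}"
  proof (rule simple_closed_path_winding_number_cases)
    have "continuous_on (path_image p) f"
      using holomorphic_on_imp_continuous_on[OF hol] imp r0 by (auto intro: continuous_on_subset)
    moreover have "simple_path p" using r0 by (simp add: p_def simple_path_circlepath)
    ultimately show "simple_path (f \<circ> p)"
      using inj[OF r0] by (intro simple_path_continuous_image) (auto simp: imp)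
    show "pathfinish (f \<circ> p) = pathstart (f \<circ> p)" using lp by (simp add: pathfinish_compose pathstart_compose)
    show "w \<notin> path_image (f \<circ> p)"
      using impz by (auto simp: path_image_compose pz_def F_def)
  qed
  \<comment> \<open>The enclosed zeros \<open>a\<close> and \<open>b\<close> each contribute at
    least 1, and no other term is negative.\<close>
  moreover have "N \<ge> 2"
  proof -
    have "a \<in> pz" "b \<in> pz" "norm a < r" "norm b < r"
      using ab r q by (auto simp: pz_def m_def F_def w_def)
    then have "(\<Sum>z\<in>{a, b}. (if norm z < r then 1 else 0) * zorder F z) \<le> N"
      unfolding N_def
    proof (intro sum_mono2 finpz)
      fix z assume "z \<in> pz - {a, b}"
      then show "0 \<le> (if norm z < r then 1 else 0) * zorder F z" using zo[of z] by simp
    qed simp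
    then show ?thesis
      using \<open>a \<noteq> b\<close> zo[OF \<open>a \<in> pz\<close>] zo[OF \<open>b \<in> pz\<close>] \<open>norm a < r\<close> \<open>norm b < r\<close> by simp
  qed
  ultimately show False
    by (auto dest: arg_cong[of _ _ Re])
qed

text \<open>
  The tangent of the image of a circle \<open>|z| = r\<close> has argument \<open>t + \<pi>/2 + Im G(r e\<^sup>i\<^sup>t)\<close>,
  whose derivative is the real part assumed to be positive.
\<close>
lemma convex_function_inj_on:
  assumes df: "\<And>z. z \<in> unit_disc \<Longrightarrow> (f has_field_derivative exp (G z)) (at z)"
    and dG: "\<And>z. z \<in> unit_disc \<Longrightarrow> (G has_field_derivative G' z) (at z)"
    and pos: "\<And>z. z \<in> unit_disc \<Longrightarrow> 0 < Re (1 + z * G' z)"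
  shows "inj_on f unit_disc"
proof (rule inj_on_ball_if_inj_on_spheres)
  show "f holomorphic_on unit_disc"
    unfolding holomorphic_on_open[OF open_ball] using df by blast
next
  fix r :: real assume r: "0 < r" "r < 1"
  define c where "c = (\<lambda>x. of_real r * cis x)"
  have c: "c x \<in> unit_disc" for x using r by (simp add: c_def norm_mult)
  have dc: "(c has_vector_derivative \<i> * c x) (at x)" for x
    unfolding c_def cis_conv_exp
    by (rule has_vector_derivative_real_field) (auto intro!: derivative_eq_intros)
  \<comment> \<open>The factor \<open>\<i>\<close> in the derivative of \<open>c\<close> accounts
    for \<open>pi / 2\<close>. Since \<open>G (c x)\<close> has period 2 pi in \<open>x\<close>,
    \<open>\<theta>\<close> gains exactly 2 pi per revolution.\<close>
  define \<theta> where "\<theta> = (\<lambda>x. x + pi / 2 + Im (G (c x)))"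
  define \<rho> where "\<rho> = (\<lambda>x. r * exp (Re (G (c x))))"
  have "inj_on (\<lambda>x. f (c x)) {0..<2 * pi}"
  proof (rule convex_closed_curve_inj_on)
    fix x
    have "((f \<circ> c) has_vector_derivative \<i> * c x * exp (G (c x))) (at x)"
      by (rule field_vector_diff_chain_at[OF dc df[OF c]])
    also have "\<i> * c x * exp (G (c x)) = of_real (\<rho> x) * cis (\<theta> x)"
    proof -
      have "cis (\<theta> x) = cis x * \<i> * cis (Im (G (c x)))"
        by (simp add: \<theta>_def cis_mult[symmetric])
      then show ?thesis
        by (simp add: c_def \<rho>_def exp_eq_polar exp_of_real)
    qed
    finally show "((\<lambda>x. f (c x)) has_vector_derivative of_real (\<rho> x) * cis (\<theta> x)) (at x)"
      by (simp add: o_def)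
    show "0 < \<rho> x" using r by (simp add: \<rho>_def)
    show "f (c (x + 2 * pi)) = f (c x)" "\<theta> (x + 2 * pi) = \<theta> x + 2 * pi"
      by (simp_all add: c_def \<theta>_def cis.ctr)
  next
    have d\<theta>: "(\<theta> has_real_derivative Re (1 + c x * G' (c x))) (at x)" for x
    proof -
      have "((G \<circ> c) has_vector_derivative \<i> * c x * G' (c x)) (at x)"
        by (rule field_vector_diff_chain_at[OF dc dG[OF c]])
      from bounded_linear.has_vector_derivative[OF bounded_linear_Im this]
      have "((\<lambda>x. Im (G (c x))) has_real_derivative Im (\<i> * c x * G' (c x))) (at x)"
        by (simp add: has_real_derivative_iff_has_vector_derivative o_def)
      from DERIV_add[OF DERIV_add[OF DERIV_ident DERIV_const[of "pi / 2"]] this]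
      show ?thesis by (simp add: \<theta>_def)
    qed
    show "strict_mono \<theta>"
    proof (rule strict_monoI)
      fix x y :: real assume "x < y"
      then show "\<theta> x < \<theta> y"
        by (rule DERIV_pos_imp_increasing) (use d\<theta> pos[OF c] in blast)
    qed
  qed
  moreover have "sphere 0 r \<subseteq> c ` {0..<2 * pi}"
  proof
    fix z :: complex assume "z \<in> sphere 0 r"
    then have z: "norm z = r" by simp
    have "z = c (Arg2pi z)"
      using Arg2pi_eq[of z] z by (simp add: c_def cis_conv_exp)
    then show "z \<in> c ` {0..<2 * pi}"
      using Arg2pi_ge_0[of z] Arg2pi_lt_2pi[of z] by auto
  qed
  ultimately show "inj_on f (sphere 0 r)"
    using inj_on_subset[OF inj_on_imageI[of f c]] by (simp add: o_def)
qed

section \<open>Logarithmic coefficients in terms of the Schwarz function\<close>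

lemma has_fps_expansion_on_disc:
  assumes "g holomorphic_on unit_disc"
  shows "g has_fps_expansion fps_expansion g 0"
  by (rule has_fps_expansion_fps_expansion[OF open_ball _ assms]) simp

lemma fps_expansion_eq_on_disc:
  assumes "f has_fps_expansion F" "g has_fps_expansion G"
    and "\<And>z. z \<in> unit_disc \<Longrightarrow> f z = g z"
  shows "F = G"
proof -
  have "\<forall>\<^sub>F z in nhds 0. f z = g z"
    using eventually_nhds_in_open[of unit_disc 0] assms(3) by (auto elim!: eventually_mono)
  with assms(1,2) show ?thesis
    using has_fps_expansion_cong fps_expansion_unique_complex by metis
qed

lemma fps_nth_expansion: "fps_nth (fps_expansion g 0) n = taylor_coeff g n"
  by (simp add: fps_expansion_def taylor_coeff_def)

text \<open>As power series, z f'' = f' (\<open>\<phi> \<circ> \<omega>\<close> - 1) determines the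
  coefficients of \<open>f\<close>, and f = z exp L converts them into those of \<open>L\<close>,
  which are twice the logarithmic coefficients.\<close>

lemma log_coeff_via_schwarz:
  assumes f: "f \<in> class_S" and h\<phi>: "\<phi> holomorphic_on unit_disc" and \<phi>0: "\<phi> 0 = 1"
    and \<omega>: "schwarz_function \<omega>"
    and sub: "\<And>z. z \<in> unit_disc \<Longrightarrow> 1 + z * deriv (deriv f) z / deriv f z = \<phi> (\<omega> z)"
  defines "b \<equiv> taylor_coeff \<phi>" and "c \<equiv> taylor_coeff \<omega>"
  shows "log_coeff f 1 = b 1 * c 1 / 4"
    and "log_coeff f 2 = (b 1 * c 2 + (b 2 + (b 1)\<^sup>2 / 4) * (c 1)\<^sup>2) / 12"
proof -
  have hf: "f holomorphic_on unit_disc" and inj: "inj_on f unit_disc"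
    and f0: "f 0 = 0" and f1: "deriv f 0 = 1"
    using f by (auto simp: class_S_def)
  have h\<omega>: "\<omega> holomorphic_on unit_disc" and \<omega>0: "\<omega> 0 = 0"
    using \<omega> by (auto simp: schwarz_function_def)
  define L where "L = (SOME L. is_log_branch f L)"
  have L: "is_log_branch f L"
    unfolding L_def using is_log_branch_exists[OF f] by (rule someI_ex)
  then have hL: "L holomorphic_on unit_disc" and L0: "L 0 = 0"
    by (auto simp: is_log_branch_def)
  have fL: "z * exp (L z) = f z" if "z \<in> unit_disc" for z
    using L f0 that by (cases "z = 0") (auto simp: is_log_branch_def)
  define F \<Phi> W \<Lambda> where "F = fps_expansion f 0" and "\<Phi> = fps_expansion \<phi> 0"
    and "W = fps_expansion \<omega> 0" and "\<Lambda> = fps_expansion L 0"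
  note defs = F_def \<Phi>_def W_def \<Lambda>_def
  have F: "f has_fps_expansion F" and \<Phi>: "\<phi> has_fps_expansion \<Phi>"
    and W: "\<omega> has_fps_expansion W" and \<Lambda>: "L has_fps_expansion \<Lambda>"
    unfolding defs using has_fps_expansion_on_disc hf h\<phi> h\<omega> hL by auto
  have nth0: "fps_nth F 0 = 0" "fps_nth F 1 = 1" "fps_nth \<Phi> 0 = 1" "fps_nth W 0 = 0" "fps_nth \<Lambda> 0 = 0"
    by (simp_all add: defs fps_nth_expansion taylor_coeff_def f0 f1 \<phi>0 \<omega>0 L0)
  \<comment> \<open>Clearing the denominator is legitimate because the derivative of a univalent
    function has no zeros.\<close>
  have "fps_X * fps_deriv (fps_deriv F) = fps_deriv F * ((\<Phi> oo W) - 1)"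
  proof (rule fps_expansion_eq_on_disc)
    show "(\<lambda>z. z * deriv (deriv f) z) has_fps_expansion fps_X * fps_deriv (fps_deriv F)"
      by (intro fps_expansion_intros F)
    show "(\<lambda>z. deriv f z * ((\<phi> \<circ> \<omega>) z - 1)) has_fps_expansion fps_deriv F * ((\<Phi> oo W) - 1)"
      by (intro fps_expansion_intros F \<Phi> W nth0)
    fix z assume z: "z \<in> unit_disc"
    then have "deriv f z \<noteq> 0"
      by (rule holomorphic_injective_imp_regular[OF hf open_ball inj])
    then show "z * deriv (deriv f) z = deriv f z * ((\<phi> \<circ> \<omega>) z - 1)"
      using sub[OF z] by (simp add: field_simps)
  qed
  then have eq1: "fps_nth (fps_X * fps_deriv (fps_deriv F)) n = fps_nth (fps_deriv F * ((\<Phi> oo W) - 1)) n" for n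
    by simp
  define E where "E = fps_exp 1 oo \<Lambda>"
  have "fps_X * E = F"
  proof (rule fps_expansion_eq_on_disc)
    show "(\<lambda>z. z * (exp \<circ> L) z) has_fps_expansion fps_X * E"
      unfolding E_def by (intro fps_expansion_intros \<Lambda> nth0)
  qed (use F fL in auto)
  \<comment> \<open>The factor z shifts indices: the coefficients 2 and 3 of \<open>f\<close> are
    the coefficients 1 and 2 of \<open>E\<close>.\<close>
  then have F_E: "fps_nth F (Suc n) = fps_nth E n" for n by (simp flip: \<open>fps_X * E = F\<close>)
  \<comment> \<open>This differential equation yields the coefficients of \<open>E\<close>
    recursively, without expanding the composed exponential.\<close>
  have E': "fps_deriv E = E * fps_deriv \<Lambda>"
    unfolding E_def by (simp add: fps_compose_deriv nth0)
  have E0: "fps_nth E 0 = 1" by (simp add: E_def)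
  have E1: "fps_nth E 1 = fps_nth \<Lambda> 1"
    using arg_cong[OF E', of "\<lambda>F. fps_nth F 0"] E0 by simp
  have E2: "2 * fps_nth E 2 = 2 * fps_nth \<Lambda> 2 + (fps_nth \<Lambda> 1)\<^sup>2"
    using arg_cong[OF E', of "\<lambda>F. fps_nth F 1"] E0 E1
    by (simp add: fps_mult_nth numeral_2_eq_2 power2_eq_square)
  have C0: "fps_nth (\<Phi> oo W) 0 = 1" by (simp add: nth0)
  have C1: "fps_nth (\<Phi> oo W) 1 = fps_nth \<Phi> 1 * fps_nth W 1"
    by (simp add: fps_compose_nth nth0)
  have C2: "fps_nth (\<Phi> oo W) 2 = fps_nth \<Phi> 1 * fps_nth W 2 + fps_nth \<Phi> 2 * (fps_nth W 1)\<^sup>2"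
    by (simp add: fps_compose_nth nth0 numeral_2_eq_2 fps_mult_nth power2_eq_square)
  \<comment> \<open>On the left of \<open>eq1\<close> the n-th coefficient is n(n+1) times
    coefficient n+1 of \<open>F\<close>; on the right the second factor has constant term 0.\<close>
  have F2: "2 * fps_nth F 2 = fps_nth \<Phi> 1 * fps_nth W 1"
    using eq1[of 1] C0 C1 nth0 by (simp add: fps_mult_nth numeral_2_eq_2)
  have F3: "6 * fps_nth F 3 = fps_nth (\<Phi> oo W) 2 + 2 * fps_nth F 2 * fps_nth (\<Phi> oo W) 1"
    using eq1[of 2] C0 nth0 by (simp add: fps_mult_nth numeral_2_eq_2 numeral_3_eq_3 algebra_simps)
  have lc: "log_coeff f n = fps_nth \<Lambda> n / 2" for n
    by (simp only: log_coeff_def L_def defs fps_nth_expansion)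
  have bc: "b n = fps_nth \<Phi> n" "c n = fps_nth W n" for n
    by (simp_all add: b_def c_def defs fps_nth_expansion)
  have l1: "fps_nth \<Lambda> 1 = b 1 * c 1 / 2"
    using F_E[of 1] E1 F2 by (simp add: bc numeral_2_eq_2 mult.commute)
  then show "log_coeff f 1 = b 1 * c 1 / 4" by (simp add: lc field_simps)
  have "12 * fps_nth \<Lambda> 2 = 6 * (2 * fps_nth E 2) - 6 * (fps_nth \<Lambda> 1)\<^sup>2"
    using E2 by simp
  also have "6 * (2 * fps_nth E 2) = 2 * (6 * fps_nth F 3)"
    using F_E[of 2] by (simp add: numeral_2_eq_2 numeral_3_eq_3)
  also have "6 * fps_nth F 3 = b 1 * c 2 + b 2 * (c 1)\<^sup>2 + (b 1 * c 1)\<^sup>2"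
    unfolding F3 F2 C1 C2 bc by (simp add: power2_eq_square)
  finally have "12 * fps_nth \<Lambda> 2 = 2 * (b 1 * c 2 + b 2 * (c 1)\<^sup>2 + (b 1 * c 1)\<^sup>2) - 6 * (b 1 * c 1 / 2)\<^sup>2"
    by (simp only: l1)
  then show "log_coeff f 2 = (b 1 * c 2 + (b 2 + (b 1)\<^sup>2 / 4) * (c 1)\<^sup>2) / 12"
    by (simp add: lc power2_eq_square field_simps)
qed

section \<open>Members of the class with a prescribed Schwarz function\<close>

text \<open>The equation prescribes f''/f' = (\<open>\<phi> \<circ> \<omega>\<close> - 1)/z.
  Integrating gives log f', and integrating its exponential gives \<open>f\<close>. Univalence comes
  from \<open>convex_function_inj_on\<close>, as \<open>\<phi>\<close> has positive real
  part.\<close>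

lemma class_C_member_exists:
  assumes h\<phi>: "\<phi> holomorphic_on unit_disc" and \<phi>0: "\<phi> 0 = 1"
    and pos: "\<And>z. z \<in> unit_disc \<Longrightarrow> 0 < Re (\<phi> z)"
    and \<omega>: "schwarz_function \<omega>"
  obtains f where "f \<in> class_C \<phi>"
    "\<And>z. z \<in> unit_disc \<Longrightarrow> 1 + z * deriv (deriv f) z / deriv f z = \<phi> (\<omega> z)"
proof -
  have h\<omega>: "\<omega> holomorphic_on unit_disc" and \<omega>0: "\<omega> 0 = 0" and im: "\<omega> ` unit_disc \<subseteq> unit_disc"
    using \<omega> by (auto simp: schwarz_function_def)
  have hp: "(\<phi> \<circ> \<omega>) holomorphic_on unit_disc"
    by (rule holomorphic_on_compose_gen[OF h\<omega> h\<phi> im])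
  have "(\<lambda>z. (\<phi> \<circ> \<omega>) z - 1) holomorphic_on unit_disc"
    by (intro holomorphic_intros hp)
  moreover have "(\<phi> \<circ> \<omega>) 0 - 1 = 0" by (simp add: \<omega>0 \<phi>0)
  ultimately obtain q where hq: "q holomorphic_on unit_disc"
    and q: "\<And>z. norm z < 1 \<Longrightarrow> (\<phi> \<circ> \<omega>) z - 1 = z * q z"
    using Schwarz3[of "\<lambda>z. (\<phi> \<circ> \<omega>) z - 1" 1] by blast
  obtain G0 where G0: "\<And>z. z \<in> unit_disc \<Longrightarrow> (G0 has_field_derivative q z) (at z)"
    using holomorphic_convex_primitive'[OF convex_ball open_ball hq] at_within_open[OF _ open_ball]
    by metis
  \<comment> \<open>Vanishing of \<open>G\<close> at 0 gives \<open>deriv f 0 = 1\<close>; the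
    constant subtracted from \<open>f0\<close> below likewise gives \<open>f 0 = 0\<close>.\<close>
  define G where "G = (\<lambda>z. G0 z - G0 0)"
  have G: "(G has_field_derivative q z) (at z)" if "z \<in> unit_disc" for z
    unfolding G_def using G0[OF that] by (auto intro!: derivative_eq_intros)
  have "G holomorphic_on unit_disc"
    unfolding holomorphic_on_open[OF open_ball] using G by blast
  then have "(\<lambda>z. exp (G z)) holomorphic_on unit_disc" by (intro holomorphic_intros)
  then obtain f0 where f0: "\<And>z. z \<in> unit_disc \<Longrightarrow> (f0 has_field_derivative exp (G z)) (at z)"
    using holomorphic_convex_primitive'[OF convex_ball open_ball] at_within_open[OF _ open_ball]
    by metis
  define f where "f = (\<lambda>z. f0 z - f0 0)"
  have f: "(f has_field_derivative exp (G z)) (at z)" if "z \<in> unit_disc" for z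
    unfolding f_def using f0[OF that] by (auto intro!: derivative_eq_intros)
  have df: "deriv f z = exp (G z)" if "z \<in> unit_disc" for z
    using f[OF that] by (rule DERIV_imp_deriv)
  have ddf: "deriv (deriv f) z = exp (G z) * q z" if "z \<in> unit_disc" for z
  proof (rule DERIV_imp_deriv)
    have "((\<lambda>z. exp (G z)) has_field_derivative exp (G z) * q z) (at z)"
      by (rule DERIV_fun_exp[OF G[OF that]])
    then show "(deriv f has_field_derivative exp (G z) * q z) (at z)"
      by (rule has_field_derivative_transform_within_open[OF _ open_ball that]) (simp add: df)
  qed
  have eq: "1 + z * deriv (deriv f) z / deriv f z = \<phi> (\<omega> z)" if "z \<in> unit_disc" for z
    using q[of z] that by (simp add: df ddf algebra_simps)
  have "inj_on f unit_disc"
  proof (rule convex_function_inj_on[OF f G])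
    fix z :: complex assume z: "z \<in> unit_disc"
    then have "1 + z * q z = \<phi> (\<omega> z)" using q[of z] by (simp add: algebra_simps)
    then show "0 < Re (1 + z * q z)" using pos im z by (metis image_subset_iff)
  qed
  moreover have "f holomorphic_on unit_disc"
    unfolding holomorphic_on_open[OF open_ball] using f by blast
  ultimately have "f \<in> class_S"
    using df[of 0] by (simp add: class_S_def f_def G_def)
  moreover have "(\<lambda>z. 1 + z * deriv (deriv f) z / deriv f z) holomorphic_on unit_disc"
    by (rule holomorphic_transform[OF hp]) (simp add: eq)
  ultimately have "f \<in> class_C \<phi>"
    using h\<phi> \<omega> eq by (auto simp: class_C_def subordinate_def)
  with eq show thesis using that by blast
qed

section \<open>The estimate and its sharpness\<close>

text \<open>The two squares are bounded separately. Since
  \<open>b \<le> \<bar>\<beta>\<bar>\<close>, replacing \<open>b\<close> by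
  \<open>\<bar>\<beta>\<bar>\<close> in front of \<open>cmod d\<close> lets the terms in |c|^2
  cancel, leaving \<open>\<bar>\<beta>\<bar>\<close> as bound for the second numerator.\<close>

lemma log_coeff_difference_bound:
  fixes b \<beta> :: real and c d :: complex
  assumes c: "cmod c \<le> 1" and d: "cmod d \<le> 1 - (cmod c)\<^sup>2" and b: "0 < b" "b \<le> \<bar>\<beta>\<bar>"
  shows "cmod ((b * c / 4)\<^sup>2 - ((b * d + \<beta> * c\<^sup>2) / 12)\<^sup>2) \<le> b\<^sup>2 / 16 + 1 / 144 * \<beta>\<^sup>2"
proof -
  have c2: "(cmod c)\<^sup>2 \<le> 1" using c by (simp add: power_le_one)
  have "cmod (b * d + \<beta> * c\<^sup>2) \<le> cmod (b * d) + cmod (\<beta> * c\<^sup>2)" by (rule norm_triangle_ineq)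
  also have "\<dots> = b * cmod d + \<bar>\<beta>\<bar> * (cmod c)\<^sup>2" using b by (simp add: norm_mult norm_power)
  also have "\<dots> \<le> \<bar>\<beta>\<bar> * (1 - (cmod c)\<^sup>2) + \<bar>\<beta>\<bar> * (cmod c)\<^sup>2"
    using b d by (intro add_mono mult_mono) auto
  finally have g2: "cmod (b * d + \<beta> * c\<^sup>2) \<le> \<bar>\<beta>\<bar>" by (simp add: algebra_simps)
  have "cmod ((b * c / 4)\<^sup>2 - ((b * d + \<beta> * c\<^sup>2) / 12)\<^sup>2)
      \<le> cmod ((b * c / 4)\<^sup>2) + cmod (((b * d + \<beta> * c\<^sup>2) / 12)\<^sup>2)"
    by (rule norm_triangle_ineq4)
  also have "\<dots> = b\<^sup>2 * (cmod c)\<^sup>2 / 16 + (cmod (b * d + \<beta> * c\<^sup>2))\<^sup>2 / 144"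
    by (simp add: norm_power norm_divide norm_mult power_divide power_mult_distrib)
  also have "\<dots> \<le> b\<^sup>2 / 16 + \<beta>\<^sup>2 / 144"
    using mult_left_mono[OF c2, of "b\<^sup>2"] power_mono[OF g2, of 2] by simp
  finally show ?thesis by simp
qed

theorem theorem2p2:
  fixes \<phi> :: "complex \<Rightarrow> complex" and B :: "nat \<Rightarrow> real"
  assumes "ma_minda \<phi>"
    and "\<And>n. B n = Re (taylor_coeff \<phi> n)"
  shows "(\<forall>z\<in>unit_disc. (\<lambda>n. complex_of_real (B n) * z ^ n) sums \<phi> z) \<and> 0 < B 1 \<and>
    (\<bar>B 2 + (B 1)\<^sup>2 / 4\<bar> \<ge> B 1 \<longrightarrow>
      (\<forall>f\<in>class_C \<phi>. cmod ((log_coeff f 1)\<^sup>2 - (log_coeff f 2)\<^sup>2)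
          \<le> (B 1)\<^sup>2 / 16 + 1 / 144 * (B 2 + (B 1)\<^sup>2 / 4)\<^sup>2) \<and>
      (\<exists>f\<in>class_C \<phi>. cmod ((log_coeff f 1)\<^sup>2 - (log_coeff f 2)\<^sup>2)
          = (B 1)\<^sup>2 / 16 + 1 / 144 * (B 2 + (B 1)\<^sup>2 / 4)\<^sup>2))"
proof (intro conjI ballI impI)
  have h\<phi>: "\<phi> holomorphic_on unit_disc" and \<phi>0: "\<phi> 0 = 1"
    and pos: "\<And>z. z \<in> unit_disc \<Longrightarrow> 0 < Re (\<phi> z)" and d: "0 < Re (deriv \<phi> 0)"
    using assms(1) by (auto simp: ma_minda_def)
  \<comment> \<open>The coefficients are real, so taking real parts in \<open>B\<close> loses
    nothing.\<close>
  have B: "taylor_coeff \<phi> n = of_real (B n)" for n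
    using taylor_coeff_real_if_conj_symmetric[OF h\<phi> ma_minda_symmetric[OF assms(1)], of n]
    by (simp add: assms(2))
  show "(\<lambda>n. complex_of_real (B n) * z ^ n) sums \<phi> z" if "z \<in> unit_disc" for z
    using holomorphic_power_series[OF h\<phi> that] by (simp add: taylor_coeff_def flip: B)
  show B1: "0 < B 1"
    using d by (simp add: assms(2) taylor_coeff_def)
  let ?\<beta> = "B 2 + (B 1)\<^sup>2 / 4"
  assume le: "B 1 \<le> \<bar>?\<beta>\<bar>"
  show "cmod ((log_coeff f 1)\<^sup>2 - (log_coeff f 2)\<^sup>2) \<le> (B 1)\<^sup>2 / 16 + 1 / 144 * ?\<beta>\<^sup>2"
    if "f \<in> class_C \<phi>" for f
  proof -
    from that obtain \<omega> where f: "f \<in> class_S" and \<omega>: "schwarz_function \<omega>"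
      and sub: "\<And>z. z \<in> unit_disc \<Longrightarrow> 1 + z * deriv (deriv f) z / deriv f z = \<phi> (\<omega> z)"
      by (auto simp: class_C_def subordinate_def)
    have lc: "log_coeff f 1 = of_real (B 1) * taylor_coeff \<omega> 1 / 4"
      "log_coeff f 2 = (of_real (B 1) * taylor_coeff \<omega> 2 + of_real ?\<beta> * (taylor_coeff \<omega> 1)\<^sup>2) / 12"
      using log_coeff_via_schwarz[OF f h\<phi> \<phi>0 \<omega> sub] by (simp_all add: B)
    show ?thesis
      using log_coeff_difference_bound[OF schwarz_function_coeffs[OF \<omega>] B1 le]
      unfolding lc B by simp
  qed
  have \<omega>: "schwarz_function (\<lambda>z. \<i> * z)"
    by (auto simp: schwarz_function_def norm_mult intro!: holomorphic_intros)
  have c: "taylor_coeff (\<lambda>z. \<i> * z) 1 = \<i>" "taylor_coeff (\<lambda>z. \<i> * z) 2 = 0"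
    by (simp_all add: taylor_coeff_def numeral_2_eq_2)
  obtain f where f: "f \<in> class_C \<phi>"
    and sub: "\<And>z. z \<in> unit_disc \<Longrightarrow> 1 + z * deriv (deriv f) z / deriv f z = \<phi> (\<i> * z)"
    using class_C_member_exists[OF h\<phi> \<phi>0 pos \<omega>] by metis
  then have fS: "f \<in> class_S" by (simp add: class_C_def)
  have lc: "log_coeff f 1 = of_real (B 1) * \<i> / 4" "log_coeff f 2 = - of_real ?\<beta> / 12"
    using log_coeff_via_schwarz[OF fS h\<phi> \<phi>0 \<omega> sub] c by (simp_all add: B)
  \<comment> \<open>The square of \<open>\<i>\<close> makes the first square a nonpositive real,
    while the second is nonnegative, so their moduli add up.\<close>
  have "(log_coeff f 1)\<^sup>2 - (log_coeff f 2)\<^sup>2 = - of_real ((B 1)\<^sup>2 / 16 + 1 / 144 * ?\<beta>\<^sup>2)"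
    unfolding lc by (simp add: power_divide power_mult_distrib power2_eq_square algebra_simps)
  then have "cmod ((log_coeff f 1)\<^sup>2 - (log_coeff f 2)\<^sup>2) = \<bar>(B 1)\<^sup>2 / 16 + 1 / 144 * ?\<beta>\<^sup>2\<bar>"
    by (metis norm_minus_cancel norm_of_real)
  also have "\<dots> = (B 1)\<^sup>2 / 16 + 1 / 144 * ?\<beta>\<^sup>2"
    by (intro abs_of_nonneg add_nonneg_nonneg) auto
  finally show "\<exists>f\<in>class_C \<phi>. cmod ((log_coeff f 1)\<^sup>2 - (log_coeff f 2)\<^sup>2)
      = (B 1)\<^sup>2 / 16 + 1 / 144 * ?\<beta>\<^sup>2"
    using f by blast
qed

end
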